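(* Let $\alpha>0$, let $l(x,u)$ be the running cost, $x_{t+1}=f(x_t,u_t)$ the deterministic dynamics with $x\in\mathbb{R}^{n_x}$ and $u\in\mathbb{R}^{n_u}$, and let $V'$ denote the value function at the next timestep. Consider the maximum entropy Bellman equation $$V(x)=\inf_{\pi}\Big\{\mathbb{E}_{\pi}\big[l(x,u)+V'(f(x,u))\big]-\alpha H[\pi]\Big\}.$$ The optimal policy $\pi^*$ solving the infimum is the Gibbs distribution $$\pi^*(u|x)=Z^{-1}\exp\Big(-\tfrac1\alpha\big[V'(f(x,u))+l(x,u)\big]\Big),$$ where $Z$ denotes the partition function $$Z(x)=\int \exp\Big(-\tfrac1\alpha\big[V'(f(x,u))+l(x,u)\big]\Big)\,du .$$ Consequently, the value function $V$ takes the form $$V(x)=-\alpha\ln Z(x).$$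
   Context: Setting: a discrete-time optimal control problem over the horizon $0,1,\dots,T$ with deterministic dynamics $x_{t+1}=f(x_t,u_t)$, states $x_t\in\mathbb{R}^{n_x}$, controls $u_t\in\mathbb{R}^{n_u}$, running costs $l_t$ and terminal cost $\Phi$. Controls are drawn from a stochastic policy $\pi_t(u_t|x_t)$ (a probability density in $u_t$ given $x_t$), and the objective is $J_\pi=\mathbb{E}_\pi\big[\Phi(x_T)+\sum_{t=0}^{T-1}\big(l_t(x_t,u_t)-\alpha H[\pi_t]\big)\big]$, where $\alpha>0$ is an inverse temperature parameter and $H[\pi]=-\mathbb{E}_\pi[\ln\pi]=-\int\pi(u)\ln\pi(u)\,du$ is the Shannon entropy. The value function is $V(x)=\min_\pi J(x,\pi)$, the minimal cost starting from $x$. In the Bellman equation the expectation is over $u\sim\pi(\cdot|x)$ and the infimum is over policies $\pi$. The time index is suppressed for nonterminal times; $V'$ is the value function at the next timestep (not a derivative).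
   Formalization: Z(x) is assumed to be a convergent integral for every x, and the Gibbs distribution is claimed optimal at x only if its expected cost E[l+V'] is finite, since otherwise its objective is infinity minus infinity; the formula for V and uniqueness of the optimum need no such condition. *)

theory Defs
  imports "HOL-Analysis.Analysis"
begin

text \<open>
  States are \<open>real ^ 'nx\<close>, controls are \<open>real ^ 'nu\<close>. A policy \<open>\<pi>\<close> is curried:
  \<open>\<pi> x u\<close> is the density \<open>\<pi>(u|x)\<close> with respect to Lebesgue measure. The Bellman equation
  at \<open>x\<close> only involves the density \<open>\<pi> x\<close>, so no regularity in \<open>x\<close> is imposed.
\<close>

definition policies :: "(real ^ 'nx \<Rightarrow> real ^ 'nu \<Rightarrow> real) set" where
  "policies = {\<pi>. \<forall>x. \<pi> x \<in> borel_measurable borel \<and> (\<forall>u. 0 \<le> \<pi> x u) \<and>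
     (\<integral>\<^sup>+u. ennreal (\<pi> x u) \<partial>lborel) = 1}"

text \<open>
  The expectation is extended-real-valued, since the infimum ranges over all policies and
  neither the expected cost nor the entropy of an arbitrary density has to be finite (the
  Bochner integral would assign such a density the value 0). Both here and in
  \<open>maxent_cost\<close> the indeterminate form \<open>\<infinity> - \<infinity>\<close> evaluates to \<open>\<infinity>\<close>, as it does for
  \<^typ>\<open>ereal\<close>; thus in the minimisation a policy whose cost is undefined counts as infeasible.
\<close>

definition expect :: "(real ^ 'nu \<Rightarrow> real) \<Rightarrow> (real ^ 'nu \<Rightarrow> real) \<Rightarrow> ereal" where
  "expect p g = enn2ereal (\<integral>\<^sup>+u. ennreal (p u * g u) \<partial>lborel)
              - enn2ereal (\<integral>\<^sup>+u. ennreal (- (p u * g u)) \<partial>lborel)"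

text \<open>Where \<open>p u = 0\<close>, the integrand \<open>p u * ln (p u)\<close> is 0, as is the usual convention.\<close>

definition shannon_entropy :: "(real ^ 'nu \<Rightarrow> real) \<Rightarrow> ereal" where
  "shannon_entropy p = - expect p (\<lambda>u. ln (p u))"

definition maxent_cost ::
  "real \<Rightarrow> (real ^ 'nx \<Rightarrow> real ^ 'nu \<Rightarrow> real) \<Rightarrow> (real ^ 'nx \<Rightarrow> real ^ 'nu \<Rightarrow> real ^ 'nx) \<Rightarrow>
   (real ^ 'nx \<Rightarrow> real) \<Rightarrow> real ^ 'nx \<Rightarrow> (real ^ 'nx \<Rightarrow> real ^ 'nu \<Rightarrow> real) \<Rightarrow> ereal" where
  "maxent_cost \<alpha> l f V' x \<pi> =
     expect (\<pi> x) (\<lambda>u. l x u + V' (f x u)) - ereal \<alpha> * shannon_entropy (\<pi> x)"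

definition partition_function ::
  "real \<Rightarrow> (real ^ 'nx \<Rightarrow> real ^ 'nu \<Rightarrow> real) \<Rightarrow> (real ^ 'nx \<Rightarrow> real ^ 'nu \<Rightarrow> real ^ 'nx) \<Rightarrow>
   (real ^ 'nx \<Rightarrow> real) \<Rightarrow> real ^ 'nx \<Rightarrow> real" where
  "partition_function \<alpha> l f V' x =
     (\<integral>u. exp (- (1 / \<alpha>) * (V' (f x u) + l x u)) \<partial>lborel)"

definition gibbs_policy ::
  "real \<Rightarrow> (real ^ 'nx \<Rightarrow> real ^ 'nu \<Rightarrow> real) \<Rightarrow> (real ^ 'nx \<Rightarrow> real ^ 'nu \<Rightarrow> real ^ 'nx) \<Rightarrow>
   (real ^ 'nx \<Rightarrow> real) \<Rightarrow> real ^ 'nx \<Rightarrow> real ^ 'nu \<Rightarrow> real" where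
  "gibbs_policy \<alpha> l f V' x u =
     inverse (partition_function \<alpha> l f V' x) * exp (- (1 / \<alpha>) * (V' (f x u) + l x u))"

end

theory Submission
  imports Defs
begin

text \<open>
  For a density \<open>p\<close> of finite cost, the cost exceeds \<open>- \<alpha> ln Z\<close> by \<open>\<alpha>\<close> times the relative entropy
  of \<open>p\<close> with respect to the Gibbs density \<open>q\<close>, i.e. by \<open>\<alpha> \<integral> (p ln p - p ln q - p + q)\<close>, whose
  integrand is nonnegative and vanishes only where \<open>p = q\<close>. The Gibbs density itself may have
  undefined cost; then \<open>- \<alpha> ln Z\<close> is still the infimum, as the renormalised restrictions of \<open>q\<close> to
  the sets where the energy is bounded by \<open>n\<close> have costs converging to it.
\<close>

section \<open>Pointwise relative entropy inequality and its equality case\<close>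

text \<open>This is \<open>ln t \<le> t - 1\<close> at \<open>t = q / p\<close>, multiplied by
  \<open>p\<close>. At \<open>p = 0\<close> it reads \<open>- q \<le> 0\<close>.\<close>

lemma diff_le_relative_entropy:
  fixes p q :: real
  assumes "0 \<le> p" "0 < q"
  shows "p - q \<le> p * ln p - p * ln q"
proof (cases "p = 0")
  case False
  with assms have "p > 0" by simp
  have "ln (q / p) \<le> q / p - 1"
    using \<open>p > 0\<close> assms by (intro ln_le_minus_one) simp
  then have "p * ln (q / p) \<le> p * (q / p - 1)"
    using \<open>p > 0\<close> by (intro mult_left_mono) auto
  then show ?thesis
    using \<open>p > 0\<close> assms by (simp add: ln_div algebra_simps)
qed (use assms in simp)

text \<open>Equality in \<open>ln t \<le> t - 1\<close> forces \<open>t = 1\<close>; the case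
  \<open>p = 0\<close> would give \<open>q = 0\<close>, contradicting \<open>0 < q\<close>.\<close>

lemma diff_eq_relative_entropy_imp_eq:
  fixes p q :: real
  assumes "0 \<le> p" "0 < q" "p * ln p - p * ln q = p - q"
  shows "p = q"
proof (cases "p = 0")
  case False
  with assms have "p > 0" by simp
  have "p * ln (q / p) = p * (q / p - 1)"
    using \<open>p > 0\<close> assms by (simp add: ln_div algebra_simps)
  then have "ln (q / p) = q / p - 1"
    using \<open>p > 0\<close> by simp
  then have "q / p = 1"
    using \<open>p > 0\<close> assms by (intro ln_eq_minus_one) auto
  then show ?thesis using \<open>p > 0\<close> by simp
qed (use assms in simp)

section \<open>Integrability criteria and the extended-real expectation\<close>

text \<open>Where \<open>f\<close> is negative its absolute value is at most that of
  \<open>h\<close>, so the minorant controls the negative part.\<close>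

lemma integrable_if_bounded_below:
  fixes f h :: "'a \<Rightarrow> real"
  assumes [measurable]: "f \<in> borel_measurable M" and h: "integrable M h"
    and le: "\<And>x. h x \<le> f x" and fin: "(\<integral>\<^sup>+x. ennreal (f x) \<partial>M) < \<infinity>"
  shows "integrable M f"
proof (rule integrableI_bounded)
  have [measurable]: "h \<in> borel_measurable M" using h by simp
  have "(\<integral>\<^sup>+x. ennreal (norm (f x)) \<partial>M) \<le> (\<integral>\<^sup>+x. ennreal (f x) + ennreal (norm (h x)) \<partial>M)"
  proof (rule nn_integral_mono)
    fix x
    show "ennreal (norm (f x)) \<le> ennreal (f x) + ennreal (norm (h x))"
    proof (cases "0 \<le> f x")
      case False
      then have "norm (f x) \<le> norm (h x)" using le[of x] by simp
      then show ?thesis by (simp add: ennreal_leI add_increasing)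
    qed simp
  qed
  also have "\<dots> = (\<integral>\<^sup>+x. ennreal (f x) \<partial>M) + (\<integral>\<^sup>+x. ennreal (norm (h x)) \<partial>M)"
    by (rule nn_integral_add) auto
  also have "\<dots> < \<infinity>"
    using fin h by (simp add: integrable_iff_bounded)
  finally show "(\<integral>\<^sup>+x. ennreal (norm (f x)) \<partial>M) < \<infinity>" .
qed simp

lemma integrable_max_0:
  fixes f :: "'a \<Rightarrow> real"
  assumes [measurable]: "f \<in> borel_measurable M" and fin: "(\<integral>\<^sup>+x. ennreal (f x) \<partial>M) < \<infinity>"
  shows "integrable M (\<lambda>x. max 0 (f x))"
proof (rule integrableI_bounded)
  have "ennreal (norm (max 0 (f x))) = ennreal (f x)" for x
    by (cases "0 \<le> f x") (auto simp: ennreal_neg max_def)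
  then show "(\<integral>\<^sup>+x. ennreal (norm (max 0 (f x))) \<partial>M) < \<infinity>" using fin by simp
qed simp

lemma expect_eq_integral:
  assumes "integrable lborel (\<lambda>u. p u * g u)"
  shows "expect p g = ereal (\<integral>u. p u * g u \<partial>lborel)"
proof -
  have "(\<integral>\<^sup>+u. ennreal (p u * g u) \<partial>lborel) \<noteq> \<infinity>" "(\<integral>\<^sup>+u. ennreal (- (p u * g u)) \<partial>lborel) \<noteq> \<infinity>"
    using assms by (auto simp: real_integrable_def)
  moreover have "enn2ereal a - enn2ereal b = ereal (enn2real a - enn2real b)"
    if "a \<noteq> \<infinity>" "b \<noteq> \<infinity>" for a b
    using that by (cases a; cases b) auto
  ultimately show ?thesis
    using assms by (simp add: expect_def real_lebesgue_integral_def)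
qed

text \<open>An infinite positive part makes the expectation \<open>\<infinity>\<close> whatever the
  negative part is, because \<open>\<infinity> - \<infinity> = \<infinity>\<close> in
  \<open>ereal\<close>.\<close>

lemma expect_finite_imp_positive_part_finite:
  assumes "expect p g \<noteq> \<infinity>"
  shows "(\<integral>\<^sup>+u. ennreal (p u * g u) \<partial>lborel) < \<infinity>"
proof (rule ccontr)
  assume "\<not> (\<integral>\<^sup>+u. ennreal (p u * g u) \<partial>lborel) < \<infinity>"
  then have "(\<integral>\<^sup>+u. ennreal (p u * g u) \<partial>lborel) = top"
    by (simp add: less_top[symmetric])
  then show False using assms by (simp add: expect_def)
qed

section \<open>Probability densities on the control space\<close>

definition prob_density :: "(real ^ 'nu \<Rightarrow> real) \<Rightarrow> bool" where
  "prob_density p \<longleftrightarrow> p \<in> borel_measurable borel \<and> (\<forall>u. 0 \<le> p u) \<and>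
     (\<integral>\<^sup>+u. ennreal (p u) \<partial>lborel) = 1"

lemma policies_iff: "\<pi> \<in> policies \<longleftrightarrow> (\<forall>x. prob_density (\<pi> x))"
  by (simp add: policies_def prob_density_def)

lemma prob_densityD:
  assumes "prob_density p"
  shows "p \<in> borel_measurable borel" "0 \<le> p u"
    "integrable lborel p" "(\<integral>u. p u \<partial>lborel) = 1"
proof -
  show p: "p \<in> borel_measurable borel" "0 \<le> p u" for u
    using assms by (auto simp: prob_density_def)
  show "integrable lborel p"
    using p assms by (intro integrableI_nonneg) (auto simp: prob_density_def)
  show "(\<integral>u. p u \<partial>lborel) = 1"
    using p assms by (subst integral_eq_nn_integral) (auto simp: prob_density_def)
qed

lemma prob_densityI:
  assumes "p \<in> borel_measurable borel" "\<And>u. 0 \<le> p u"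
    and "integrable lborel p" "(\<integral>u. p u \<partial>lborel) = 1"
  shows "prob_density p"
  using assms nn_integral_eq_integral[of lborel p] by (simp add: prob_density_def)

section \<open>The Gibbs density and the minimisation at a fixed state\<close>

text \<open>The Bellman problem at \<open>x\<close> sees a policy only through its density at
  \<open>x\<close>, so the state is frozen and \<open>g u\<close> stands for the energy
  \<open>l x u + V' (f x u)\<close>.\<close>

locale gibbs =
  fixes \<alpha> :: real and g :: "real ^ 'nu \<Rightarrow> real"
  assumes alpha_pos: "\<alpha> > 0"
    and weight_integrable: "integrable lborel (\<lambda>u. exp (- (1 / \<alpha>) * g u))"
begin

definition Z :: real where "Z = (\<integral>u. exp (- (1 / \<alpha>) * g u) \<partial>lborel)"

definition q :: "real ^ 'nu \<Rightarrow> real" where "q u = inverse Z * exp (- (1 / \<alpha>) * g u)"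

definition cost :: "(real ^ 'nu \<Rightarrow> real) \<Rightarrow> ereal" where
  "cost p = expect p g - ereal \<alpha> * shannon_entropy p"

text \<open>Measurability is inherited from the integrable weight, since \<open>g\<close> is
  \<open>- \<alpha>\<close> times its logarithm.\<close>

lemma measurable_g [measurable]: "g \<in> borel_measurable borel"
proof -
  have "(\<lambda>u. exp (- (1 / \<alpha>) * g u)) \<in> borel_measurable borel"
    using borel_measurable_integrable[OF weight_integrable] by simp
  then have "(\<lambda>u. - \<alpha> * ln (exp (- (1 / \<alpha>) * g u))) \<in> borel_measurable borel"
    by measurable
  then show ?thesis using alpha_pos by simp
qed

text \<open>The weight is strictly positive, so a vanishing integral would make Lebesgue measure
  zero.\<close>

lemma Z_pos: "Z > 0"
proof -
  have "Z \<noteq> 0"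
  proof
    assume "Z = 0"
    then have "AE u in lborel. exp (- (1 / \<alpha>) * g u) = 0"
      using integral_nonneg_eq_0_iff_AE[OF weight_integrable] by (simp add: Z_def)
    then have "AE u in (lborel :: (real ^ 'nu) measure). False" by simp
    then have "emeasure lborel (UNIV :: (real ^ 'nu) set) = 0"
      by (simp add: AE_iff_measurable[of UNIV])
    then show False by simp
  qed
  moreover have "Z \<ge> 0" by (simp add: Z_def)
  ultimately show ?thesis by simp
qed

lemma q_pos: "q u > 0"
  using Z_pos by (simp add: q_def)

lemma ln_q: "ln (q u) = - g u / \<alpha> - ln Z"
  using Z_pos by (simp add: q_def ln_mult ln_inverse)

lemma prob_density_q: "prob_density q"
proof (rule prob_densityI)
  show "integrable lborel q" unfolding q_def using weight_integrable by simp
  have "(\<integral>u. q u \<partial>lborel) = inverse Z * Z"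
    unfolding q_def Z_def by (rule integral_mult_right_zero)
  then show "(\<integral>u. q u \<partial>lborel) = 1" using Z_pos by simp
  show "q \<in> borel_measurable borel"
    unfolding q_def by measurable
qed (use q_pos in \<open>auto intro: less_imp_le\<close>)

lemmas measurable_q [measurable] = prob_densityD(1)[OF prob_density_q]

lemma cost_eq_integral:
  assumes "integrable lborel (\<lambda>u. p u * g u)" "integrable lborel (\<lambda>u. p u * ln (p u))"
  shows "cost p = ereal ((\<integral>u. p u * g u \<partial>lborel) + \<alpha> * (\<integral>u. p u * ln (p u) \<partial>lborel))"
  using assms by (simp add: cost_def shannon_entropy_def expect_eq_integral)

text \<open>A cost other than \<open>\<infinity>\<close> bounds the positive parts of both
  \<open>p * g\<close> and \<open>p * ln p\<close>. Their weighted sum has an integrable minorant,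
  so the negative part of each is controlled by the positive part of the other.\<close>

lemma cost_finite_imp_integrable:
  assumes p: "prob_density p" and "cost p \<noteq> \<infinity>"
  shows "integrable lborel (\<lambda>u. p u * g u)" "integrable lborel (\<lambda>u. p u * ln (p u))"
proof -
  note [measurable] = prob_densityD(1)[OF p]
  have "expect p g \<noteq> \<infinity>" "expect p (\<lambda>u. ln (p u)) \<noteq> \<infinity>"
    using assms(2) alpha_pos unfolding cost_def shannon_entropy_def by auto
  note fin = this[THEN expect_finite_imp_positive_part_finite]
  \<comment> \<open>The minorant comes from \<open>p - q \<le> p * ln p - p * ln q\<close>, scaled
    by \<open>\<alpha>\<close>, with \<open>ln_q\<close> substituted for
    \<open>ln q\<close>.\<close>
  define h where "h u = \<alpha> * (p u - q u) - \<alpha> * ln Z * p u" for u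
  have h: "integrable lborel h"
    unfolding h_def using prob_densityD(3)[OF p] prob_densityD(3)[OF prob_density_q] by auto
  have h_le: "h u \<le> p u * g u + \<alpha> * (p u * ln (p u))" for u
  proof -
    have "\<alpha> * (p u - q u) \<le> \<alpha> * (p u * ln (p u) - p u * ln (q u))"
      using diff_le_relative_entropy[OF prob_densityD(2)[OF p] q_pos] alpha_pos
      by (intro mult_left_mono) auto
    moreover have "\<alpha> * (p u * ln (q u)) = - (p u * g u) - \<alpha> * ln Z * p u"
      using alpha_pos by (simp add: ln_q algebra_simps)
    ultimately show ?thesis by (simp add: h_def right_diff_distrib)
  qed
  show "integrable lborel (\<lambda>u. p u * g u)"
  proof (rule integrable_if_bounded_below)
    show "integrable lborel (\<lambda>u. h u - \<alpha> * max 0 (p u * ln (p u)))"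
      using h integrable_max_0[OF _ fin(2)] by simp
    show "h u - \<alpha> * max 0 (p u * ln (p u)) \<le> p u * g u" for u
    proof -
      have "\<alpha> * (p u * ln (p u)) \<le> \<alpha> * max 0 (p u * ln (p u))"
        using alpha_pos by (intro mult_left_mono) auto
      then show ?thesis using h_le[of u] by linarith
    qed
  qed (use fin in simp_all)
  show "integrable lborel (\<lambda>u. p u * ln (p u))"
  proof (rule integrable_if_bounded_below)
    show "integrable lborel (\<lambda>u. (h u - max 0 (p u * g u)) / \<alpha>)"
      using h integrable_max_0[OF _ fin(1)] by simp
    show "(h u - max 0 (p u * g u)) / \<alpha> \<le> p u * ln (p u)" for u
    proof -
      have "h u - max 0 (p u * g u) \<le> \<alpha> * (p u * ln (p u))" using h_le[of u] by linarith
      then show ?thesis using alpha_pos by (simp add: field_simps)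
    qed
  qed (use fin in simp_all)
qed

section \<open>Excess cost over the Gibbs density, lower bound and uniqueness\<close>

text \<open>The correction \<open>p u - q u\<close> integrates to 0 for densities, so the integral
  is still the relative entropy, but it makes the integrand pointwise nonnegative.\<close>

definition excess :: "(real ^ 'nu \<Rightarrow> real) \<Rightarrow> real ^ 'nu \<Rightarrow> real" where
  "excess p u = p u * ln (p u) - p u * ln (q u) - (p u - q u)"

lemma excess_nonneg: "prob_density p \<Longrightarrow> 0 \<le> excess p u"
  using diff_le_relative_entropy[OF prob_densityD(2) q_pos] by (simp add: excess_def)

text \<open>By \<open>ln_q\<close> the excess is a linear combination of \<open>p * ln p\<close>,
  \<open>p * g\<close>, \<open>p\<close> and \<open>q\<close>, all integrable when the cost is
  finite; the unit masses of \<open>p\<close> and \<open>q\<close> leave only \<open>ln Z\<close> as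
  constant.\<close>

lemma
  assumes p: "prob_density p" and fin: "cost p \<noteq> \<infinity>"
  shows integrable_excess: "integrable lborel (excess p)"
    and cost_eq_excess: "cost p = ereal (- \<alpha> * ln Z + \<alpha> * (\<integral>u. excess p u \<partial>lborel))"
proof -
  note int = cost_finite_imp_integrable[OF p fin] prob_densityD(3)[OF p]
    prob_densityD(3)[OF prob_density_q]
  have *: "excess p = (\<lambda>u. p u * ln (p u) + p u * g u / \<alpha> + ln Z * p u - p u + q u)"
    by (rule ext) (simp add: excess_def ln_q algebra_simps)
  show "integrable lborel (excess p)" unfolding * using int by simp
  have "(\<integral>u. excess p u \<partial>lborel) =
      (\<integral>u. p u * ln (p u) \<partial>lborel) + (\<integral>u. p u * g u \<partial>lborel) / \<alpha> + ln Z"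
    unfolding * using int prob_densityD(4)[OF p] prob_densityD(4)[OF prob_density_q] by simp
  then show "cost p = ereal (- \<alpha> * ln Z + \<alpha> * (\<integral>u. excess p u \<partial>lborel))"
    using alpha_pos int by (simp add: cost_eq_integral field_simps)
qed

lemma cost_ge:
  assumes "prob_density p"
  shows "ereal (- \<alpha> * ln Z) \<le> cost p"
proof (cases "cost p = \<infinity>")
  case False
  have "0 \<le> (\<integral>u. excess p u \<partial>lborel)"
    using excess_nonneg[OF assms] by simp
  then show ?thesis
    using alpha_pos by (simp add: cost_eq_excess[OF assms False])
qed simp

text \<open>Minimal cost makes the integral of the nonnegative excess vanish, so the pointwise
  equality case applies almost everywhere.\<close>

lemma cost_minimal_imp_AE_eq:
  assumes p: "prob_density p" and min: "cost p = ereal (- \<alpha> * ln Z)"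
  shows "AE u in lborel. p u = q u"
proof -
  have fin: "cost p \<noteq> \<infinity>" using min by simp
  have "(\<integral>u. excess p u \<partial>lborel) = 0"
    using cost_eq_excess[OF p fin] min alpha_pos by simp
  then have "AE u in lborel. excess p u = 0"
    using integral_nonneg_eq_0_iff_AE[OF integrable_excess[OF p fin]] excess_nonneg[OF p] by simp
  then show ?thesis
  proof eventually_elim
    case (elim u)
    then show ?case
      using diff_eq_relative_entropy_imp_eq[OF prob_densityD(2)[OF p] q_pos]
      by (simp add: excess_def)
  qed
qed

text \<open>Since \<open>q * ln q\<close> is a combination of \<open>q * g\<close> and
  \<open>q\<close>, the hypothesis makes both expectations finite; the excess of \<open>q\<close>
  over itself is 0.\<close>

lemma cost_q:
  assumes "integrable lborel (\<lambda>u. q u * g u)"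
  shows "cost q = ereal (- \<alpha> * ln Z)"
proof -
  have "(\<lambda>u. q u * ln (q u)) = (\<lambda>u. - (q u * g u / \<alpha>) - ln Z * q u)"
    by (simp add: ln_q algebra_simps)
  then have "integrable lborel (\<lambda>u. q u * ln (q u))"
    using assms prob_densityD(3)[OF prob_density_q] by simp
  then have fin: "cost q \<noteq> \<infinity>"
    using cost_eq_integral[OF assms] by simp
  show ?thesis
    using cost_eq_excess[OF prob_density_q fin] by (simp add: excess_def)
qed

section \<open>Truncated Gibbs densities approximating the infimum\<close>

definition mass :: "nat \<Rightarrow> real" where
  "mass n = (\<integral>u. q u * indicator {u. \<bar>g u\<bar> \<le> real n} u \<partial>lborel)"

definition truncated :: "nat \<Rightarrow> real ^ 'nu \<Rightarrow> real" where
  "truncated n u = q u * indicator {u. \<bar>g u\<bar> \<le> real n} u / mass n"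

text \<open>Dominated convergence with bound \<open>q\<close>: each \<open>u\<close> lies in the
  truncation set once \<open>n\<close> reaches the absolute value of \<open>g u\<close>.\<close>

lemma mass_tendsto: "mass \<longlonglongrightarrow> 1"
proof -
  have "(\<lambda>n. \<integral>u. q u * indicator {u. \<bar>g u\<bar> \<le> real n} u \<partial>lborel) \<longlonglongrightarrow> (\<integral>u. q u \<partial>lborel)"
  proof (rule integral_dominated_convergence[where w = q])
    show "AE u in lborel. (\<lambda>n. q u * indicator {u. \<bar>g u\<bar> \<le> real n} u) \<longlonglongrightarrow> q u"
    proof (rule AE_I2)
      fix u
      have "\<forall>\<^sub>F n in sequentially. q u * indicator {u. \<bar>g u\<bar> \<le> real n} u = q u"
        using eventually_ge_at_top[of "nat \<lceil>\<bar>g u\<bar>\<rceil>"]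
        by eventually_elim (auto simp: nat_le_iff ceiling_le_iff)
      then show "(\<lambda>n. q u * indicator {u. \<bar>g u\<bar> \<le> real n} u) \<longlonglongrightarrow> q u"
        by (rule tendsto_eventually)
    qed
    show "AE u in lborel. norm (q u * indicator {u. \<bar>g u\<bar> \<le> real n} u) \<le> q u" for n
      using q_pos by (auto simp: indicator_def less_imp_le)
  qed (use prob_densityD(3)[OF prob_density_q] in simp_all)
  then show ?thesis
    using prob_densityD(4)[OF prob_density_q] by (simp add: mass_def[abs_def])
qed

text \<open>On the truncation set \<open>ln (truncated n u)\<close> is
  \<open>ln (q u) - ln (mass n)\<close>, so the energy terms of the cost cancel and only constants
  remain.\<close>

lemma
  assumes m: "mass n > 0"
  shows prob_density_truncated: "prob_density (truncated n)"
    and cost_truncated: "cost (truncated n) = ereal (- \<alpha> * ln Z - \<alpha> * ln (mass n))"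
proof -
  have [measurable]: "truncated n \<in> borel_measurable borel"
    unfolding truncated_def by measurable
  have qi: "integrable lborel (\<lambda>u. q u * indicator {u. \<bar>g u\<bar> \<le> real n} u)"
    by (rule Bochner_Integration.integrable_bound[OF prob_densityD(3)[OF prob_density_q]])
      (auto simp: indicator_def)
  have ti: "integrable lborel (truncated n)"
    unfolding truncated_def using qi by simp
  have t1: "(\<integral>u. truncated n u \<partial>lborel) = 1"
    unfolding truncated_def using m by (simp add: mass_def)
  have nonneg: "0 \<le> truncated n u" for u
    using q_pos[of u] m by (simp add: truncated_def)
  show "prob_density (truncated n)"
    by (rule prob_densityI) (use nonneg ti t1 in auto)
  \<comment> \<open>The energy is at most \<open>n\<close> in absolute value wherever the truncated
    density is nonzero.\<close>
  have gi: "integrable lborel (\<lambda>u. truncated n u * g u)"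
  proof (rule Bochner_Integration.integrable_bound)
    show "integrable lborel (\<lambda>u. real n * truncated n u)" using ti by simp
    show "AE u in lborel. norm (truncated n u * g u) \<le> norm (real n * truncated n u)"
    proof (rule AE_I2)
      fix u
      have "\<bar>g u\<bar> \<le> real n \<or> truncated n u = 0" by (auto simp: truncated_def)
      then show "norm (truncated n u * g u) \<le> norm (real n * truncated n u)"
        by (elim disjE) (simp_all add: abs_mult mult.commute[of "real n"] mult_left_mono)
    qed
  qed simp
  \<comment> \<open>The formula for the logarithm holds only on the truncation set; elsewhere the
    factor \<open>truncated n u\<close> makes both sides 0.\<close>
  have *: "(\<lambda>u. truncated n u * ln (truncated n u)) =
      (\<lambda>u. - (truncated n u * g u / \<alpha>) - (ln Z + ln (mass n)) * truncated n u)"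
  proof
    fix u
    show "truncated n u * ln (truncated n u) =
        - (truncated n u * g u / \<alpha>) - (ln Z + ln (mass n)) * truncated n u"
    proof (cases "\<bar>g u\<bar> \<le> real n")
      case True
      then have "truncated n u = q u / mass n" by (simp add: truncated_def)
      then have "ln (truncated n u) = - g u / \<alpha> - ln Z - ln (mass n)"
        using q_pos[of u] m by (simp add: ln_div ln_q)
      then show ?thesis by (simp only:) (simp add: algebra_simps)
    qed (simp add: truncated_def)
  qed
  have li: "integrable lborel (\<lambda>u. truncated n u * ln (truncated n u))"
    unfolding * using gi ti by simp
  have "(\<integral>u. truncated n u * ln (truncated n u) \<partial>lborel) =
      - ((\<integral>u. truncated n u * g u \<partial>lborel) / \<alpha>) - (ln Z + ln (mass n))"
    unfolding * using gi ti t1 by simp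
  then show "cost (truncated n) = ereal (- \<alpha> * ln Z - \<alpha> * ln (mass n))"
    using cost_eq_integral[OF gi li] alpha_pos by (simp add: field_simps)
qed

text \<open>The bound is applied to the truncated densities, whose masses are eventually positive
  and tend to 1. This covers the case where \<open>q\<close> itself has cost
  \<open>\<infinity>\<close>.\<close>

lemma le_if_le_cost:
  assumes "\<And>p. prob_density p \<Longrightarrow> c \<le> cost p"
  shows "c \<le> ereal (- \<alpha> * ln Z)"
proof (rule tendsto_lowerbound)
  have "(\<lambda>n. - \<alpha> * ln Z - \<alpha> * ln (mass n)) \<longlonglongrightarrow> - \<alpha> * ln Z - \<alpha> * ln 1"
    by (intro tendsto_intros mass_tendsto) simp
  then show "(\<lambda>n. ereal (- \<alpha> * ln Z - \<alpha> * ln (mass n))) \<longlonglongrightarrow> ereal (- \<alpha> * ln Z)"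
    by simp
  have "\<forall>\<^sub>F n in sequentially. mass n > 0"
    using order_tendstoD(1)[OF mass_tendsto, of 0] by simp
  then show "\<forall>\<^sub>F n in sequentially. c \<le> ereal (- \<alpha> * ln Z - \<alpha> * ln (mass n))"
  proof eventually_elim
    case (elim n)
    show ?case
      using assms[OF prob_density_truncated[OF elim]] cost_truncated[OF elim] by simp
  qed
qed simp

end

section \<open>The Bellman equation for policies\<close>

text \<open>Attainment carries an integrability premise because otherwise the Gibbs policy has cost
  \<open>\<infinity>\<close> at \<open>x\<close>, by \<open>cost_finite_imp_integrable\<close>. The
  formula for \<open>V\<close> holds at every state. Uniqueness is up to null sets, as the cost
  depends on a density only through integrals.\<close>

theorem lemma1:
  fixes \<alpha> :: real
    and l :: "real ^ 'nx \<Rightarrow> real ^ 'nu \<Rightarrow> real"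
    and f :: "real ^ 'nx \<Rightarrow> real ^ 'nu \<Rightarrow> real ^ 'nx"
    and V' :: "real ^ 'nx \<Rightarrow> real"
    and V :: "real ^ 'nx \<Rightarrow> ereal"
  assumes alpha_pos: "\<alpha> > 0"
    and Z_finite: "\<And>x. integrable lborel (\<lambda>u. exp (- (1 / \<alpha>) * (V' (f x u) + l x u)))"
    and bellman: "\<And>x. V x = (INF \<pi>\<in>policies. maxent_cost \<alpha> l f V' x \<pi>)"
  shows "gibbs_policy \<alpha> l f V' \<in> policies
    \<and> (\<forall>x. integrable lborel (\<lambda>u. gibbs_policy \<alpha> l f V' x u * (l x u + V' (f x u))) \<longrightarrow>
          is_arg_min (maxent_cost \<alpha> l f V' x) (\<lambda>\<pi>. \<pi> \<in> policies) (gibbs_policy \<alpha> l f V'))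
    \<and> (\<forall>x \<pi>. is_arg_min (maxent_cost \<alpha> l f V' x) (\<lambda>\<pi>. \<pi> \<in> policies) \<pi> \<longrightarrow>
          (AE u in lborel. \<pi> x u = gibbs_policy \<alpha> l f V' x u))
    \<and> (\<forall>x. V x = ereal (- \<alpha> * ln (partition_function \<alpha> l f V' x)))"
proof -
  define g where "g x u = l x u + V' (f x u)" for x u
  define \<gamma> where "\<gamma> = gibbs_policy \<alpha> l f V'"
  interpret G: gibbs \<alpha> "g x" for x
    by unfold_locales (use alpha_pos Z_finite[of x] in \<open>simp_all add: g_def add.commute\<close>)
  have Z: "partition_function \<alpha> l f V' x = G.Z x" for x
    by (simp add: partition_function_def G.Z_def g_def add.commute)
  have q: "\<gamma> x = G.q x" for x
    by (rule ext) (simp add: \<gamma>_def gibbs_policy_def G.q_def Z g_def add.commute)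
  have cost: "maxent_cost \<alpha> l f V' x \<pi> = G.cost x (\<pi> x)" for x \<pi>
    unfolding maxent_cost_def G.cost_def by (simp add: g_def[abs_def])
  have \<gamma>: "\<gamma> \<in> policies"
    by (simp add: policies_iff q G.prob_density_q)
  have ge: "ereal (- \<alpha> * ln (G.Z x)) \<le> maxent_cost \<alpha> l f V' x \<pi>" if "\<pi> \<in> policies" for x \<pi>
    using that G.cost_ge by (simp only: cost policies_iff)
  have le: "c \<le> ereal (- \<alpha> * ln (G.Z x))"
    if c: "\<And>\<pi>. \<pi> \<in> policies \<Longrightarrow> c \<le> maxent_cost \<alpha> l f V' x \<pi>" for c x
  proof (rule G.le_if_le_cost)
    fix p :: "real ^ 'nu \<Rightarrow> real" assume "prob_density p"
    \<comment> \<open>A density at \<open>x\<close> extends to a policy by overriding the Gibbs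
      policy there; the other states do not enter the cost at \<open>x\<close>.\<close>
    then have "\<gamma>(x := p) \<in> policies" using \<gamma> by (simp add: policies_iff)
    then show "c \<le> G.cost x p" using c[of "\<gamma>(x := p)"] by (simp add: cost)
  qed
  have "is_arg_min (maxent_cost \<alpha> l f V' x) (\<lambda>\<pi>. \<pi> \<in> policies) \<gamma>"
    if "integrable lborel (\<lambda>u. \<gamma> x u * (l x u + V' (f x u)))" for x
    using that \<gamma> ge[of _ x] G.cost_q[of x]
    by (auto simp: is_arg_min_linorder cost q g_def)
  moreover have "AE u in lborel. \<pi> x u = \<gamma> x u"
    if min: "is_arg_min (maxent_cost \<alpha> l f V' x) (\<lambda>\<pi>. \<pi> \<in> policies) \<pi>" for x \<pi>
  proof -
    have \<pi>: "\<pi> \<in> policies" using min by (simp add: is_arg_min_linorder)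
    \<comment> \<open>The minimal cost is itself a lower bound for all costs, so \<open>le\<close>
      applies even when the Gibbs policy does not attain the infimum.\<close>
    have "maxent_cost \<alpha> l f V' x \<pi> \<le> ereal (- \<alpha> * ln (G.Z x))"
      by (rule le) (use min in \<open>simp add: is_arg_min_linorder\<close>)
    then have "G.cost x (\<pi> x) = ereal (- \<alpha> * ln (G.Z x))"
      using ge[OF \<pi>, of x] by (simp only: cost order_antisym)
    then show ?thesis
      using G.cost_minimal_imp_AE_eq \<pi> by (simp add: q policies_iff)
  qed
  moreover have "V x = ereal (- \<alpha> * ln (G.Z x))" for x
    unfolding bellman
    by (intro antisym INF_greatest le ge INF_lower)
  ultimately show ?thesis
    using \<gamma> by (simp only: Z flip: \<gamma>_def) blast
qed

end
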